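(* Let $A$ and $C$ be separable $C^*$-algebras, let $p:C\to A$ be a surjective $*$-homomorphism, let $E$ be a $C^*$-algebra, and let $(\psi_+,\psi_-)$ be a pseudohomomorphism from $A$ to $E$, given by $*$-homomorphisms $\psi_\pm:C\to E$. Let $s:A\to C$ be a $\mathbb C$-homogeneous $*$-respecting continuous map such that $p(s(a))=a$ for any $a\in A$, and set $\mu_\pm=\psi_\pm\circ s:A\to E$. Then the pair $(\mu_+,\mu_-)$ has the same deficiency from being a $*$-homomorphism.
   Context: Given a surjective $*$-homomorphism $p:C\to A$, a pair $(\varphi_+,\varphi_-)$ of $*$-homomorphisms $\varphi_\pm:C\to E$ is a pseudohomomorphism from $A$ to $E$ if $\varphi_+|_{\operatorname{Ker}p}=\varphi_-|_{\operatorname{Ker}p}$. Let $(\mu_+,\mu_-)$ be a pair of maps $\mu_\pm:A\to E$, not necessarily additive or multiplicative, but homogeneous ($\mu_\pm(\lambda a)=\lambda\mu_\pm(a)$ for $\lambda\in\mathbb C$) and involutive ($\mu_\pm(a^* )=\mu_\pm(a)^*$). Let $F=C^*(\mu_+(A),\mu_-(A))\subset E$ be the $C^*$-algebra generated by all $\mu_\pm(a)$, $a\in A$. Let $I(\mu_+,\mu_-)\subset F$ be the ideal in $F$ generated by $\mu_+(a)-\mu_-(a)$, $a\in A$. Let $J(\mu_+,\mu_-)\subset F$ be the ideal in $F$ generated by all elements $\mu_\pm(a+b)-\mu_\pm(a)-\mu_\pm(b)$ and $\mu_\pm(ab)-\mu_\pm(a)\mu_\pm(b)$, $a,b\in A$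 (for both signs). Ideals are closed and two-sided. A pair $(\mu_+,\mu_-)$ of continuous homogeneous involutive maps $A\to E$ has the same deficiency from being a $*$-homomorphism if $I(\mu_+,\mu_-)\cap J(\mu_+,\mu_-)=0$. *)

theory Defs
  imports "HOL-Analysis.Analysis"
begin

class cscale =
  fixes cscale :: "complex \<Rightarrow> 'a \<Rightarrow> 'a"  (infixr \<open>*\<^sub>C\<close> 75)

class star_op =
  fixes star :: "'a \<Rightarrow> 'a"  (\<open>(_\<^sup>\<star>)\<close> [1000] 999)

text \<open>C*-algebras are not assumed unital: \<^class>\<open>real_normed_algebra\<close> has no unit.\<close>

class cstar_algebra = real_normed_algebra + complete_space + cscale + star_op +
  assumes cscale_add_right: "z *\<^sub>C (x + y) = z *\<^sub>C x + z *\<^sub>C y"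
    and cscale_add_left: "(z + w) *\<^sub>C x = z *\<^sub>C x + w *\<^sub>C x"
    and cscale_cscale: "z *\<^sub>C w *\<^sub>C x = (z * w) *\<^sub>C x"
    and cscale_of_real: "complex_of_real r *\<^sub>C x = r *\<^sub>R x"
    and mult_cscale_left: "(z *\<^sub>C x) * y = z *\<^sub>C (x * y)"
    and mult_cscale_right: "x * (z *\<^sub>C y) = z *\<^sub>C (x * y)"
    and norm_cscale: "norm (z *\<^sub>C x) = cmod z * norm x"
    and star_star: "(x\<^sup>\<star>)\<^sup>\<star> = x"
    and star_add: "(x + y)\<^sup>\<star> = x\<^sup>\<star> + y\<^sup>\<star>"
    and star_cscale: "(z *\<^sub>C x)\<^sup>\<star> = cnj z *\<^sub>C x\<^sup>\<star>"
    and star_mult: "(x * y)\<^sup>\<star> = y\<^sup>\<star> * x\<^sup>\<star>"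
    and cstar_identity: "norm (x\<^sup>\<star> * x) = (norm x)\<^sup>2"

instantiation complex :: cstar_algebra
begin

definition cscale_complex :: "complex \<Rightarrow> complex \<Rightarrow> complex"
  where "cscale_complex z x = z * x"

definition star_complex :: "complex \<Rightarrow> complex"
  where "star_complex x = cnj x"

instance
  by standard
    (auto simp: cscale_complex_def star_complex_def algebra_simps scaleR_conv_of_real
      norm_mult power2_eq_square)

end

definition homogeneous :: "('a::cstar_algebra \<Rightarrow> 'b::cstar_algebra) \<Rightarrow> bool"
  where "homogeneous f \<longleftrightarrow> (\<forall>z x. f (z *\<^sub>C x) = z *\<^sub>C f x)"

definition involutive :: "('a::cstar_algebra \<Rightarrow> 'b::cstar_algebra) \<Rightarrow> bool"
  where "involutive f \<longleftrightarrow> (\<forall>x. f (x\<^sup>\<star>) = (f x)\<^sup>\<star>)"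

definition star_hom :: "('a::cstar_algebra \<Rightarrow> 'b::cstar_algebra) \<Rightarrow> bool"
  where "star_hom f \<longleftrightarrow>
    (\<forall>x y. f (x + y) = f x + f y) \<and> (\<forall>x y. f (x * y) = f x * f y) \<and>
    homogeneous f \<and> involutive f"

definition pseudohomomorphism ::
  "('c::cstar_algebra \<Rightarrow> 'a::cstar_algebra) \<Rightarrow> ('c \<Rightarrow> 'e::cstar_algebra) \<Rightarrow> ('c \<Rightarrow> 'e) \<Rightarrow> bool"
  where "pseudohomomorphism p \<phi>p \<phi>m \<longleftrightarrow>
    star_hom p \<and> surj p \<and> star_hom \<phi>p \<and> star_hom \<phi>m \<and>
    (\<forall>c. p c = 0 \<longrightarrow> \<phi>p c = \<phi>m c)"

definition cstar_subalgebra :: "'e::cstar_algebra set \<Rightarrow> bool"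
  where "cstar_subalgebra B \<longleftrightarrow>
    closed B \<and> 0 \<in> B \<and> (\<forall>x\<in>B. \<forall>y\<in>B. x + y \<in> B \<and> x * y \<in> B) \<and>
    (\<forall>z. \<forall>x\<in>B. z *\<^sub>C x \<in> B) \<and> (\<forall>x\<in>B. x\<^sup>\<star> \<in> B)"

definition closed_ideal_in :: "'e::cstar_algebra set \<Rightarrow> 'e set \<Rightarrow> bool"
  where "closed_ideal_in F K \<longleftrightarrow>
    K \<subseteq> F \<and> closed K \<and> 0 \<in> K \<and> (\<forall>x\<in>K. \<forall>y\<in>K. x + y \<in> K) \<and>
    (\<forall>z. \<forall>x\<in>K. z *\<^sub>C x \<in> K) \<and> (\<forall>f\<in>F. \<forall>x\<in>K. f * x \<in> K \<and> x * f \<in> K)"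

definition pair_algebra :: "('a::cstar_algebra \<Rightarrow> 'e::cstar_algebra) \<Rightarrow> ('a \<Rightarrow> 'e) \<Rightarrow> 'e set"
  where "pair_algebra \<mu>p \<mu>m = cstar_subalgebra hull (range \<mu>p \<union> range \<mu>m)"

definition difference_ideal :: "('a::cstar_algebra \<Rightarrow> 'e::cstar_algebra) \<Rightarrow> ('a \<Rightarrow> 'e) \<Rightarrow> 'e set"
  where "difference_ideal \<mu>p \<mu>m =
    closed_ideal_in (pair_algebra \<mu>p \<mu>m) hull (range (\<lambda>a. \<mu>p a - \<mu>m a))"

definition defects :: "('a::cstar_algebra \<Rightarrow> 'e::cstar_algebra) \<Rightarrow> 'e set"
  where "defects \<mu> =
    {\<mu> (a + b) - \<mu> a - \<mu> b | a b. True} \<union> {\<mu> (a * b) - \<mu> a * \<mu> b | a b. True}"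

definition deficiency_ideal :: "('a::cstar_algebra \<Rightarrow> 'e::cstar_algebra) \<Rightarrow> ('a \<Rightarrow> 'e) \<Rightarrow> 'e set"
  where "deficiency_ideal \<mu>p \<mu>m =
    closed_ideal_in (pair_algebra \<mu>p \<mu>m) hull (defects \<mu>p \<union> defects \<mu>m)"

definition same_deficiency :: "('a::cstar_algebra \<Rightarrow> 'e::cstar_algebra) \<Rightarrow> ('a \<Rightarrow> 'e) \<Rightarrow> bool"
  where "same_deficiency \<mu>p \<mu>m \<longleftrightarrow>
    (\<forall>\<mu>\<in>{\<mu>p, \<mu>m}. continuous_on UNIV \<mu> \<and> homogeneous \<mu> \<and> involutive \<mu>) \<and>
    difference_ideal \<mu>p \<mu>m \<inter> deficiency_ideal \<mu>p \<mu>m = {0}"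

end

theory Submission
  imports Defs
begin

text \<open>
  Let \<open>K\<close> be the closure of \<open>\<psi>\<^sub>+(Ker p) = \<psi>\<^sub>-(Ker p)\<close>. Since \<open>Ker p\<close> is an ideal of \<open>C\<close>, all of \<open>F\<close>
  multiplies \<open>K\<close> into itself, and \<open>K\<close> contains the defects of \<open>\<mu>\<^sub>\<plusminus>\<close>; hence \<open>J \<subseteq> K\<close>. For \<open>k \<in> Ker p\<close>,
  \<open>(\<psi>\<^sub>+(c) - \<psi>\<^sub>-(c)) \<psi>\<^sub>\<plusminus>(k) = \<psi>\<^sub>+(c k) - \<psi>\<^sub>-(c k) = 0\<close>, so \<open>I\<close> annihilates \<open>K\<close>. If \<open>x \<in> I \<inter> J\<close>, then
  \<open>x\<^sup>\<star> \<in> K\<close>, so \<open>x x\<^sup>\<star> = 0\<close> and \<open>x = 0\<close>.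

  Continuity of \<open>\<mu>\<^sub>\<plusminus>\<close> rests on the automatic continuity of *-homomorphisms, which is proved without
  spectral theory: if \<open>a\<close> is self-adjoint and \<open>\<parallel>a\<parallel> \<le> 1/2\<close>, Banach's fixed point theorem gives
  \<open>g = 1 - sqrt (1 - a\<^sup>2)\<close>, and \<open>a + i (1 - g)\<close> is a unitary with real part \<open>a\<close>. Its image is again a
  unitary, whence \<open>\<parallel>\<phi>(a)\<parallel> \<le> 1\<close>.
\<close>

section \<open>Elementary facts on C*-algebras\<close>

lemma cscale_minus_one: "(- 1) *\<^sub>C x = - (x::'a::cstar_algebra)"
  using cscale_of_real[of "-1" x] by simp

lemma cscale_one: "1 *\<^sub>C x = (x::'a::cstar_algebra)"
  using cscale_of_real[of 1 x] by simp

lemma cscale_zero_right: "z *\<^sub>C (0::'a::cstar_algebra) = 0"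
  using cscale_add_right[of z 0 "0::'a"] by simp

lemma cscale_minus_right: "z *\<^sub>C (- x) = - (z *\<^sub>C (x::'a::cstar_algebra))"
  using cscale_add_right[of z x "- x"] by (simp add: cscale_zero_right add_eq_0_iff)

lemma cscale_diff_right: "z *\<^sub>C (x - y) = z *\<^sub>C x - z *\<^sub>C (y::'a::cstar_algebra)"
  using cscale_add_right[of z x "- y"] by (simp add: cscale_minus_right)

lemma cscale_minus_left: "(- z) *\<^sub>C x = - (z *\<^sub>C (x::'a::cstar_algebra))"
  using cscale_cscale[of "-1" z x] by (simp add: cscale_minus_one)

lemma star_minus: "(- x)\<^sup>\<star> = - (x::'a::cstar_algebra)\<^sup>\<star>"
  using star_cscale[of "-1" x] by (simp add: cscale_minus_one)

lemma star_diff: "(x - y)\<^sup>\<star> = x\<^sup>\<star> - (y::'a::cstar_algebra)\<^sup>\<star>"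
  using star_add[of x "- y"] by (simp add: star_minus)

lemma star_zero: "(0::'a::cstar_algebra)\<^sup>\<star> = 0"
  using star_add[of "0::'a" 0] by simp

lemma star_scaleR: "(r *\<^sub>R x)\<^sup>\<star> = r *\<^sub>R (x::'a::cstar_algebra)\<^sup>\<star>"
  using star_cscale[of "complex_of_real r" x] by (simp add: cscale_of_real)

text \<open>The C*-identity and submultiplicativity bound \<open>norm y\<close> by
  \<open>norm (y\<^sup>\<star>)\<close> after cancelling one factor; using this for \<open>x\<close>
  and for \<open>x\<^sup>\<star>\<close> gives both inequalities.\<close>

lemma norm_star: "norm (x\<^sup>\<star>) = norm (x::'a::cstar_algebra)"
proof -
  have le: "norm y \<le> norm (y\<^sup>\<star>)" for y :: 'a
  proof (cases "norm y = 0")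
    case False
    have "norm y * norm y \<le> norm (y\<^sup>\<star>) * norm y"
      using norm_mult_ineq[of "y\<^sup>\<star>" y] by (simp add: cstar_identity power2_eq_square)
    with False show ?thesis by simp
  qed simp
  show ?thesis using le[of x] le[of "x\<^sup>\<star>"] by (simp add: star_star)
qed

lemma bounded_linear_star: "bounded_linear (star :: 'a::cstar_algebra \<Rightarrow> 'a)"
  by (rule bounded_linear_intro[where K = 1]) (simp_all add: star_add star_scaleR norm_star)

lemma bounded_linear_cscale: "bounded_linear ((*\<^sub>C) z :: 'a::cstar_algebra \<Rightarrow> 'a)"
proof (rule bounded_linear_intro[where K = "cmod z"])
  show "z *\<^sub>C (r *\<^sub>R x) = r *\<^sub>R (z *\<^sub>C x)" for r and x :: 'a
    by (simp add: cscale_of_real[symmetric] cscale_cscale mult.commute)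
qed (simp_all add: cscale_add_right norm_cscale)

lemmas continuous_on_star = bounded_linear.continuous_on[OF bounded_linear_star]

lemma star_mult_self_eq_0: "x * x\<^sup>\<star> = 0 \<Longrightarrow> x = (0::'a::cstar_algebra)"
  using cstar_identity[of "x\<^sup>\<star>"] by (simp add: star_star norm_star)

section \<open>Automatic continuity of *-homomorphisms\<close>

text \<open>Substitute for monotonicity of the norm on positive elements. By \<open>comm\<close> the
  cross terms cancel, so x + iy and x - iy both have norm \<open>sqrt ?N\<close>, and their sum is
  2x.\<close>

lemma norm_le_sum_of_squares:
  fixes x y :: "'a::cstar_algebra"
  assumes comm: "x\<^sup>\<star> * y = y\<^sup>\<star> * x"
  shows "(norm x)\<^sup>2 \<le> norm (x\<^sup>\<star> * x + y\<^sup>\<star> * y)"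
proof -
  let ?N = "norm (x\<^sup>\<star> * x + y\<^sup>\<star> * y)"
  have norm_eq: "norm (x + \<i> *\<^sub>C w) = sqrt (norm (x\<^sup>\<star> * x + w\<^sup>\<star> * w))"
    if "x\<^sup>\<star> * w = w\<^sup>\<star> * x" for w
  proof -
    have "(x + \<i> *\<^sub>C w)\<^sup>\<star> * (x + \<i> *\<^sub>C w) = x\<^sup>\<star> * x + w\<^sup>\<star> * w"
      by (simp add: star_add star_cscale cscale_minus_left cscale_diff_right cscale_add_right
          algebra_simps mult_cscale_left mult_cscale_right cscale_cscale cscale_one that)
    then show ?thesis
      using cstar_identity[of "x + \<i> *\<^sub>C w"] by simp
  qed
  have n1: "norm (x + \<i> *\<^sub>C y) = sqrt ?N" and n2: "norm (x - \<i> *\<^sub>C y) = sqrt ?N"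
    using norm_eq[of y] norm_eq[of "- y"] comm by (simp_all add: star_minus cscale_minus_right)
  have "2 * norm x = norm ((x + \<i> *\<^sub>C y) + (x - \<i> *\<^sub>C y))"
    by (simp flip: scaleR_2)
  also have "\<dots> \<le> 2 * sqrt ?N"
    using norm_triangle_ineq[of "x + \<i> *\<^sub>C y" "x - \<i> *\<^sub>C y"] by (simp add: n1 n2)
  finally have "norm x \<le> sqrt ?N" by simp
  then show ?thesis
    by (metis norm_ge_zero power_mono real_sqrt_pow2)
qed

text \<open>
  The last hypothesis says that \<open>k + i (1 - l)\<close> is unitary in the unitization; lacking a unit, real
  and imaginary part are multiplied by \<open>k\<close>.
\<close>

lemma norm_le_1_if_circle:
  fixes k l :: "'a::cstar_algebra"
  assumes k: "k\<^sup>\<star> = k" and l: "l\<^sup>\<star> = l" and comm: "k * l = l * k"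
    and circle: "k * k + l * l = l + l"
  shows "norm k \<le> 1"
proof -
  define x y where "x = k * k" and "y = k - l * k"
  have kl: "k * (l * z) = l * (k * z)" for z
    by (metis comm mult.assoc)
  have "x\<^sup>\<star> * y = y\<^sup>\<star> * x"
    by (simp add: x_def y_def star_mult star_diff k l algebra_simps comm kl)
  then have "(norm x)\<^sup>2 \<le> norm (x\<^sup>\<star> * x + y\<^sup>\<star> * y)"
    by (rule norm_le_sum_of_squares)
  \<comment> \<open>The bracket vanishes by \<open>circle\<close>, which leaves a comparison of the
    fourth and second powers of \<open>norm k\<close>.\<close>
  also have "x\<^sup>\<star> * x + y\<^sup>\<star> * y = k * (k * k + l * l - (l + l)) * k + k * k"
    by (simp add: x_def y_def star_mult star_diff k l algebra_simps)
  also have "\<dots> = k * k"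
    using circle by simp
  finally have "((norm k)\<^sup>2)\<^sup>2 \<le> (norm k)\<^sup>2"
    using cstar_identity[of k] by (simp add: k x_def)
  then have "(norm k)\<^sup>2 * (norm k)\<^sup>2 \<le> 1 * (norm k)\<^sup>2"
    by (simp add: power2_eq_square)
  then have "(norm k)\<^sup>2 \<le> 1"
    by (cases "norm k = 0") (simp_all only: mult_le_cancel_right, simp_all add: not_less)
  then show ?thesis
    by (simp add: abs_square_le_1)
qed

text \<open>Halved, the last equation makes \<open>g\<close> a fixed point of \<open>f\<close>.
  Self-adjointness and commutation with \<open>a\<close> are closed conditions preserved by
  \<open>f\<close>, so they are built into the domain \<open>S\<close> of the iteration.\<close>

lemma circle_completion:
  fixes a :: "'a::cstar_algebra"
  assumes a: "a\<^sup>\<star> = a" and small: "norm a \<le> 1 / 2"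
  obtains g where "g\<^sup>\<star> = g" and "a * g = g * a" and "a * a + g * g = g + g"
proof -
  define S where "S = {g::'a. norm g \<le> 1 / 2 \<and> g\<^sup>\<star> = g \<and> a * g = g * a}"
  define f where "f g = (1 / 2) *\<^sub>R (a * a + g * g)" for g
  have "closed S"
    unfolding S_def
    by (intro closed_Collect_conj closed_Collect_le closed_Collect_eq continuous_intros
        continuous_on_star)
  then have complete: "complete S"
    by (simp add: complete_eq_closed)
  have nonempty: "S \<noteq> {}"
    unfolding S_def using star_zero by (auto intro!: exI[of _ 0])
  have maps: "f \<in> S \<rightarrow> S"
  proof
    fix g assume g: "g \<in> S"
    have sq: "norm (h * h) \<le> 1 / 4" if "norm h \<le> 1 / 2" for h :: 'a
      using norm_mult_ineq[of h h] mult_mono[OF that that] by simp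
    have "norm (f g) \<le> 1 / 2"
      using norm_triangle_ineq[of "a * a" "g * g"] sq[OF small] sq[of g] g
      by (simp add: f_def S_def)
    moreover have "a * (g * g) = g * (g * a)"
      using g unfolding S_def by (metis (mono_tags, lifting) mem_Collect_eq mult.assoc)
    ultimately show "f g \<in> S"
      using g by (simp add: S_def f_def star_scaleR star_add star_mult a algebra_simps)
  qed
  have contraction: "dist (f g) (f h) \<le> (1 / 2) * dist g h" if "g \<in> S" "h \<in> S" for g h
  proof -
    have "norm (g * (g - h)) \<le> 1 / 2 * norm (g - h)"
      using norm_mult_ineq[of g "g - h"] mult_right_mono[of "norm g" "1/2" "norm (g - h)"] that
      by (simp add: S_def)
    moreover have "norm ((g - h) * h) \<le> 1 / 2 * norm (g - h)"
      using norm_mult_ineq[of "g - h" h] mult_left_mono[of "norm h" "1/2" "norm (g - h)"] that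
      by (simp add: S_def)
    \<comment> \<open>The mixed terms \<open>g * h\<close> cancel, so this holds for noncommuting
      \<open>g\<close> and \<open>h\<close>; the radius 1/2 of \<open>S\<close> then gives the
      constant 1/2.\<close>
    moreover have "f g - f h = (1 / 2) *\<^sub>R (g * (g - h) + (g - h) * h)"
      by (simp add: f_def algebra_simps)
    ultimately show ?thesis
      using norm_triangle_ineq[of "g * (g - h)" "(g - h) * h"] by (simp add: dist_norm)
  qed
  obtain g where g: "g \<in> S" "f g = g"
    using Banach_fix[OF complete nonempty, of "1/2" f] maps contraction
    by (auto simp: Pi_iff image_subset_iff)
  have "a * a + g * g = 2 *\<^sub>R f g"
    by (simp add: f_def)
  with g have "a * a + g * g = g + g"
    by (simp add: scaleR_2)
  with g that show ?thesis
    unfolding S_def by blast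
qed

section \<open>Algebraic rules and boundedness for *-homomorphisms\<close>

lemma star_hom_add: "star_hom f \<Longrightarrow> f (x + y) = f x + f y"
  and star_hom_mult: "star_hom f \<Longrightarrow> f (x * y) = f x * f y"
  and star_hom_cscale: "star_hom f \<Longrightarrow> f (z *\<^sub>C x) = z *\<^sub>C f x"
  and star_hom_star: "star_hom f \<Longrightarrow> f (x\<^sup>\<star>) = (f x)\<^sup>\<star>"
  by (simp_all add: star_hom_def homogeneous_def involutive_def)

lemma star_hom_scaleR: "star_hom f \<Longrightarrow> f (r *\<^sub>R x) = r *\<^sub>R f x"
  by (metis cscale_of_real star_hom_cscale)

lemma star_hom_zero: "star_hom f \<Longrightarrow> f 0 = 0"
  using star_hom_add[of f 0 0] by simp

lemma star_hom_diff: "star_hom f \<Longrightarrow> f (x - y) = f x - f y"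
  using star_hom_add[of f "x - y" y] by simp

text \<open>The circle relations are algebraic, so \<open>f\<close> carries them over to the image
  of \<open>a\<close> scaled to norm 1/2, which thus has norm at most 1. Undoing the scaling gives
  the factor 2.\<close>

lemma star_hom_norm_self_adjoint:
  assumes f: "star_hom f" and a: "a\<^sup>\<star> = a"
  shows "norm (f a) \<le> 2 * norm a"
proof (cases "a = 0")
  case True
  then show ?thesis by (simp add: star_hom_zero[OF f])
next
  case False
  define t where "t = inverse (2 * norm a)"
  define b where "b = t *\<^sub>R a"
  have t: "t > 0"
    using False by (simp add: t_def)
  have b: "b\<^sup>\<star> = b" "norm b \<le> 1 / 2"
    using False by (simp_all add: b_def t_def star_scaleR a)
  obtain g where g: "g\<^sup>\<star> = g" "b * g = g * b" "b * b + g * g = g + g"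
    using circle_completion[OF b] .
  have "norm (f b) \<le> 1"
    by (rule norm_le_1_if_circle[of _ "f g"])
      (metis b(1) g f star_hom_star star_hom_mult star_hom_add)+
  then have "t * norm (f a) \<le> 1"
    using t by (simp add: b_def star_hom_scaleR[OF f])
  then show ?thesis
    using False by (simp add: t_def field_simps)
qed

text \<open>The C*-identity reduces the bound to the self-adjoint element
  \<open>x\<^sup>\<star> * x\<close>; the factor 2 there becomes \<open>sqrt 2\<close>.\<close>

theorem star_hom_bounded_linear:
  assumes f: "star_hom f"
  shows "bounded_linear f"
proof (rule bounded_linear_intro[where K = "sqrt 2"])
  fix x
  have "(norm (f x))\<^sup>2 = norm (f (x\<^sup>\<star> * x))"
    by (simp add: star_hom_mult[OF f] star_hom_star[OF f] cstar_identity)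
  also have "\<dots> \<le> 2 * (norm x)\<^sup>2"
    using star_hom_norm_self_adjoint[OF f, of "x\<^sup>\<star> * x"]
    by (simp add: star_mult star_star cstar_identity)
  also have "\<dots> = (norm x * sqrt 2)\<^sup>2"
    by (simp add: power_mult_distrib)
  finally show "norm (f x) \<le> norm x * sqrt 2"
    by (rule power2_le_imp_le) simp
qed (simp_all add: star_hom_add[OF f] star_hom_scaleR[OF f])

section \<open>The two ideals\<close>

lemma cstar_subalgebra_pair_algebra: "cstar_subalgebra (pair_algebra f g)"
  unfolding pair_algebra_def
  by (rule hull_in) (auto simp: cstar_subalgebra_def intro: closed_Inter)

lemma range_subset_pair_algebra:
  "f a \<in> pair_algebra f g" "g a \<in> pair_algebra f g"
  unfolding pair_algebra_def by (auto intro: hull_inc)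

lemma cstar_subalgebra_diff:
  "\<lbrakk>cstar_subalgebra B; x \<in> B; y \<in> B\<rbrakk> \<Longrightarrow> x - y \<in> B"
  unfolding cstar_subalgebra_def by (metis cscale_minus_one diff_conv_add_uminus)

text \<open>Prepares the bound of the deficiency ideal by an ideal that is cut down to
  \<open>pair_algebra f g\<close> and must still contain the generators.\<close>

lemma defects_subset_pair_algebra:
  "defects f \<subseteq> pair_algebra f g" "defects g \<subseteq> pair_algebra f g"
proof -
  have "x * y \<in> pair_algebra f g" if "x \<in> pair_algebra f g" "y \<in> pair_algebra f g" for x y
    using cstar_subalgebra_pair_algebra[of f g] that by (simp add: cstar_subalgebra_def)
  then show "defects f \<subseteq> pair_algebra f g" "defects g \<subseteq> pair_algebra f g"
    unfolding defects_def
    by (auto intro!: cstar_subalgebra_diff[OF cstar_subalgebra_pair_algebra]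
        range_subset_pair_algebra)
qed

lemma zero_in_ideal_hull: "0 \<in> closed_ideal_in F hull S"
  by (auto simp: hull_def closed_ideal_in_def)

text \<open>Closure under products is left out: the multiplicative behaviour of \<open>K\<close>
  enters only through its multipliers.\<close>

definition star_subspace :: "'e::cstar_algebra set \<Rightarrow> bool"
  where "star_subspace K \<longleftrightarrow> closed K \<and> 0 \<in> K \<and> (\<forall>x\<in>K. \<forall>y\<in>K. x + y \<in> K) \<and>
    (\<forall>z. \<forall>x\<in>K. z *\<^sub>C x \<in> K) \<and> (\<forall>x\<in>K. x\<^sup>\<star> \<in> K)"

lemma star_subspace_closure:
  assumes "0 \<in> L" and add: "\<And>x y. \<lbrakk>x \<in> L; y \<in> L\<rbrakk> \<Longrightarrow> x + y \<in> L"
    and scale: "\<And>z x. x \<in> L \<Longrightarrow> z *\<^sub>C x \<in> L" and star: "\<And>x. x \<in> L \<Longrightarrow> x\<^sup>\<star> \<in> L"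
  shows "star_subspace (closure L)"
  unfolding star_subspace_def
proof (intro conjI ballI allI)
  show "0 \<in> closure L"
    using assms(1) closure_subset by blast
  show "x + y \<in> closure L" if xy: "x \<in> closure L" "y \<in> closure L" for x y
  proof -
    obtain u v where "\<forall>n. u n \<in> L" "u \<longlonglongrightarrow> x" "\<forall>n. v n \<in> L" "v \<longlonglongrightarrow> y"
      using xy unfolding closure_sequential by blast
    then have "\<forall>n. u n + v n \<in> L" "(\<lambda>n. u n + v n) \<longlonglongrightarrow> x + y"
      by (simp_all add: add tendsto_add)
    then show ?thesis
      unfolding closure_sequential by (intro exI[of _ "\<lambda>n. u n + v n"] conjI)
  qed
  have image: "h x \<in> closure L"
    if "x \<in> closure L" "bounded_linear h" "\<And>x. x \<in> L \<Longrightarrow> h x \<in> L" for h x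
    using image_closure_subset[of L h "closure L"] that closure_subset[of L]
      bounded_linear.continuous_on[OF that(2) continuous_on_id] by blast
  show "z *\<^sub>C x \<in> closure L" if "x \<in> closure L" for z x
    using that bounded_linear_cscale scale by (rule image)
  show "x\<^sup>\<star> \<in> closure L" if "x \<in> closure L" for x
    using that bounded_linear_star star by (rule image)
qed simp

text \<open>Reduces the invariance of \<open>K\<close> under a generated C*-algebra to a check on
  generators.\<close>

lemma cstar_subalgebra_multipliers:
  assumes K: "star_subspace K"
  shows "cstar_subalgebra {f. \<forall>x\<in>K. f * x \<in> K \<and> x * f \<in> K}" (is "cstar_subalgebra ?M")
proof -
  have "closed {f. f * x \<in> K}" "closed {f. x * f \<in> K}" for x
    using K continuous_closed_vimage[of K "\<lambda>f. f * x"] continuous_closed_vimage[of K "\<lambda>f. x * f"]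
    by (auto simp: star_subspace_def vimage_def intro!: continuous_intros)
  then have "closed ?M"
    unfolding Collect_ball_eq by (intro closed_INT closed_Collect_conj ballI)
  moreover have "f\<^sup>\<star> * x \<in> K" "x * f\<^sup>\<star> \<in> K" if "f \<in> ?M" "x \<in> K" for f x
  proof -
    \<comment> \<open>The star exchanges left and right multiplication, which is why multipliers are
      taken two-sided.\<close>
    have "(x\<^sup>\<star> * f)\<^sup>\<star> \<in> K" "(f * x\<^sup>\<star>)\<^sup>\<star> \<in> K"
      using that K by (simp_all add: star_subspace_def)
    then show "f\<^sup>\<star> * x \<in> K" "x * f\<^sup>\<star> \<in> K"
      by (simp_all add: star_mult star_star)
  qed
  moreover have "f * g * x \<in> K" "x * (f * g) \<in> K" if "f \<in> ?M" "g \<in> ?M" "x \<in> K" for f g x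
    using that by (simp add: mult.assoc, simp flip: mult.assoc)
  ultimately show ?thesis
    using K by (simp add: cstar_subalgebra_def star_subspace_def distrib_left distrib_right
        mult_cscale_left mult_cscale_right)
qed

text \<open>Both ideals are hulls, so each is bounded by one ideal containing its generators:
  \<open>?F \<inter> K\<close> for the defects, the left annihilator \<open>?Ann\<close> of
  \<open>K\<close> for the differences.\<close>

lemma ideals_meet_trivially:
  assumes K: "star_subspace K"
    and mult: "\<And>a x. x \<in> K \<Longrightarrow> f a * x \<in> K \<and> x * f a \<in> K \<and> g a * x \<in> K \<and> x * g a \<in> K"
    and diff: "\<And>a x. x \<in> K \<Longrightarrow> (f a - g a) * x = 0"
    and defects: "defects f \<subseteq> K" "defects g \<subseteq> K"
  shows "difference_ideal f g \<inter> deficiency_ideal f g = {0}"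
proof -
  let ?F = "pair_algebra f g"
  let ?Ann = "{x \<in> ?F. \<forall>y\<in>K. x * y = 0}"
  note F = cstar_subalgebra_pair_algebra[of f g, unfolded cstar_subalgebra_def]
  have "?F \<subseteq> {f. \<forall>x\<in>K. f * x \<in> K \<and> x * f \<in> K}"
    unfolding pair_algebra_def
    by (rule hull_minimal) (use mult cstar_subalgebra_multipliers[OF K] in auto)
  then have F_mult: "h * x \<in> K" "x * h \<in> K" if "h \<in> ?F" "x \<in> K" for h x
    using that by auto
  have "closed_ideal_in ?F (?F \<inter> K)"
    using F K F_mult by (auto simp: closed_ideal_in_def star_subspace_def)
  then have deficiency: "deficiency_ideal f g \<subseteq> ?F \<inter> K"
    unfolding deficiency_ideal_def
    by (intro hull_minimal) (use defects defects_subset_pair_algebra in blast)+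
  have "closed {x. \<forall>y\<in>K. x * y = 0}"
    unfolding Collect_ball_eq by (intro closed_INT closed_Collect_eq continuous_intros ballI)
  then have "closed ?Ann"
    using F closed_Int[of ?F] by (simp add: Collect_conj_eq)
  \<comment> \<open>Right multiples stay in \<open>?Ann\<close> because
    \<open>(x * h) * y = x * (h * y)\<close> with \<open>h * y\<close> again in
    \<open>K\<close>.\<close>
  then have "closed_ideal_in ?F ?Ann"
    using F F_mult
    by (auto simp: closed_ideal_in_def distrib_right mult_cscale_left cscale_zero_right mult.assoc)
  then have difference: "difference_ideal f g \<subseteq> ?Ann"
    unfolding difference_ideal_def
    by (intro hull_minimal)
      (use diff in \<open>auto intro!: cstar_subalgebra_diff[OF cstar_subalgebra_pair_algebra]
        range_subset_pair_algebra\<close>)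
  have "x = 0" if "x \<in> difference_ideal f g" "x \<in> deficiency_ideal f g" for x
  proof (rule star_mult_self_eq_0)
    have "x\<^sup>\<star> \<in> K"
      using that(2) deficiency K by (auto simp: star_subspace_def)
    then show "x * x\<^sup>\<star> = 0"
      using that(1) difference by auto
  qed
  moreover have "0 \<in> difference_ideal f g" "0 \<in> deficiency_ideal f g"
    by (simp_all add: difference_ideal_def deficiency_ideal_def zero_in_ideal_hull)
  ultimately show ?thesis
    by auto
qed

section \<open>Pseudohomomorphisms composed with a section\<close>

theorem lemma12:
  fixes p :: "'c::cstar_algebra \<Rightarrow> 'a::cstar_algebra"
    and \<psi>p \<psi>m :: "'c \<Rightarrow> 'e::cstar_algebra"
    and s :: "'a \<Rightarrow> 'c"
  assumes "separable_space (euclidean :: 'a topology)"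
    and "separable_space (euclidean :: 'c topology)"
    and "star_hom p" and "surj p"
    and "pseudohomomorphism p \<psi>p \<psi>m"
    and "homogeneous s" and "involutive s" and "continuous_on UNIV s"
    and "\<And>a. p (s a) = a"
  shows "same_deficiency (\<psi>p \<circ> s) (\<psi>m \<circ> s)"
proof -
  have p: "star_hom p" and \<psi>: "star_hom \<psi>p" "star_hom \<psi>m"
    and agree: "\<And>c. p c = 0 \<Longrightarrow> \<psi>p c = \<psi>m c"
    using assms(5) by (auto simp: pseudohomomorphism_def)
  note hom_simps = star_hom_add star_hom_diff star_hom_mult star_hom_cscale star_hom_star
    star_hom_zero
  have regular: "continuous_on UNIV (\<psi> \<circ> s) \<and> homogeneous (\<psi> \<circ> s) \<and> involutive (\<psi> \<circ> s)"
    if "star_hom \<psi>" for \<psi> :: "'c \<Rightarrow> 'e"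
    using assms(6-8) that bounded_linear.continuous_on[OF star_hom_bounded_linear[OF that], of UNIV s]
    by (auto simp: homogeneous_def involutive_def hom_simps comp_def)
  define L where "L = \<psi>p ` {c. p c = 0}"
  \<comment> \<open>Taking the closure spares the theorem that images of *-homomorphisms are
    closed.\<close>
  define K where "K = closure L"
  have L: "\<psi>p c \<in> L" "\<psi>m c \<in> L" if "p c = 0" for c
    using that by (auto simp: L_def simp flip: agree[OF that])
  have K: "star_subspace K"
    unfolding K_def
  proof (rule star_subspace_closure)
    show "0 \<in> L"
      using L(1)[of 0] by (simp add: hom_simps p \<psi>)
    show "x + y \<in> L" if "x \<in> L" "y \<in> L" for x y
      using that L(1) unfolding L_def by (auto simp: hom_simps p simp flip: star_hom_add[OF \<psi>(1)])
    show "z *\<^sub>C x \<in> L" if "x \<in> L" for z x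
      using that L(1) unfolding L_def
      by (auto simp: hom_simps p cscale_zero_right simp flip: star_hom_cscale[OF \<psi>(1)])
    show "x\<^sup>\<star> \<in> L" if "x \<in> L" for x
      using that L(1) star_zero[where 'a = 'a] unfolding L_def
      by (auto simp: hom_simps p simp flip: star_hom_star[OF \<psi>(1)])
  qed
  \<comment> \<open>Density argument: closed conditions on \<open>K\<close> are checked on images of
    the kernel alone.\<close>
  have closure_L: "h x \<in> T"
    if "x \<in> K" "continuous_on UNIV h" "closed T" "\<And>c. p c = 0 \<Longrightarrow> h (\<psi>p c) \<in> T"
    for h :: "'e \<Rightarrow> 'e" and x T
    using image_closure_subset[of L h T] that continuous_on_subset[OF that(2)]
    unfolding K_def L_def by blast
  have K_mult: "\<psi> d * x \<in> K \<and> x * \<psi> d \<in> K" if x: "x \<in> K" and "\<psi> \<in> {\<psi>p, \<psi>m}" for \<psi> d x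
  proof -
    have "\<psi> d * \<psi>p c \<in> L" "\<psi>p c * \<psi> d \<in> L" if "p c = 0" for c
    proof -
      \<comment> \<open>The kernel is an ideal, so it contains both products; on it
        \<open>\<psi>p c\<close> may be exchanged for \<open>\<psi> c\<close>, and multiplicativity
        of \<open>\<psi>\<close> applies.\<close>
      have "\<psi> (d * c) \<in> L" "\<psi> (c * d) \<in> L"
        using \<open>\<psi> \<in> {\<psi>p, \<psi>m}\<close> that L by (auto simp: star_hom_mult[OF p])
      moreover have "\<psi>p c = \<psi> c"
        using \<open>\<psi> \<in> {\<psi>p, \<psi>m}\<close> agree[OF that] by auto
      ultimately show "\<psi> d * \<psi>p c \<in> L" "\<psi>p c * \<psi> d \<in> L"
        using \<open>\<psi> \<in> {\<psi>p, \<psi>m}\<close> \<psi> by (auto simp: star_hom_mult)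
    qed
    then have "\<psi> d * \<psi>p c \<in> K" "\<psi>p c * \<psi> d \<in> K" if "p c = 0" for c
      using that closure_subset unfolding K_def by blast+
    then show ?thesis
      using closure_L[OF x, of "\<lambda>y. \<psi> d * y" K] closure_L[OF x, of "\<lambda>y. y * \<psi> d" K]
      by (simp add: K_def continuous_intros)
  qed
  have annihilate: "(\<psi>p d - \<psi>m d) * x = 0" if "x \<in> K" for d x
  proof -
    \<comment> \<open>\<open>agree\<close> is used twice: at \<open>c\<close>, to rewrite the right
      factor, and at \<open>d * c\<close>, to make the two products equal.\<close>
    have "(\<psi>p d - \<psi>m d) * \<psi>p c = 0" if "p c = 0" for c
      using agree[OF that] agree[of "d * c"] that
      by (simp add: hom_simps p \<psi> left_diff_distrib)
    then show ?thesis
      using closure_L[OF that, of "\<lambda>y. (\<psi>p d - \<psi>m d) * y" "{0}"] by (simp add: continuous_intros)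
  qed
  have "defects (\<psi> \<circ> s) \<subseteq> K" if "\<psi> \<in> {\<psi>p, \<psi>m}" for \<psi>
  proof -
    have "star_hom \<psi>"
      using that \<psi> by auto
    have "\<psi> c \<in> K" if "p c = 0" for c
      using L[OF that] \<open>\<psi> \<in> {\<psi>p, \<psi>m}\<close> closure_subset unfolding K_def by blast
    \<comment> \<open>Each defect of \<open>\<psi> \<circ> s\<close> is the image under
      \<open>\<psi>\<close> of the same defect of \<open>s\<close>, which \<open>p\<close> kills
      because \<open>p (s a) = a\<close>.\<close>
    from this[of "s (a + b) - s a - s b" for a b] this[of "s (a * b) - s a * s b" for a b]
    show ?thesis
      by (auto simp: defects_def hom_simps p \<open>star_hom \<psi>\<close> assms(9))
  qed
  then have "difference_ideal (\<psi>p \<circ> s) (\<psi>m \<circ> s) \<inter> deficiency_ideal (\<psi>p \<circ> s) (\<psi>m \<circ> s) = {0}"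
    using K_mult annihilate by (intro ideals_meet_trivially[OF K]) auto
  with regular \<psi> show ?thesis
    by (simp add: same_deficiency_def)
qed

end
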